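(* There exists a polynomial-time algorithm that, given a graph $G$ with no universal vertices, determines whether the equation $c_{\min}(G)=2$ holds or not.
   Context: Graphs are finite, simple and undirected, with nonempty vertex set; polynomial time is measured with respect to the size of the input graph. A vertex $v$ is universal if it is adjacent to all other vertices of $G$. A set $S\subseteq V(G)$ is a dominating set of $G$ if every vertex of $V(G)\setminus S$ is adjacent to a vertex of $S$. All parts of a partition are nonempty. Two disjoint sets $X,Y\subseteq V(G)$ form a coalition in $G$ if neither $X$ nor $Y$ is a dominating set of $G$ but $X\cup Y$ is a dominating set of $G$. A $c$-partition of $G$ is a partition $\{V_1,\ldots,V_k\}$ of $V(G)$ such that each $V_i$ either is a dominating set consisting of a single vertex, or forms a coalition with some other set $V_j$ ($j\neq i$) of the partition. For partitions $\mathcal{A},\mathcal{B}$ of $V(G)$, $\mathcal{B}$ is a refinement of $\mathcal{A}$ if every set of $\mathcal{B}$ is equal to or a proper subset of some set of $\mathcal{A}$; it is a proper refinement if moreover $\mathcal{A}\ne\mathcal{B}$. A $c$-partition is minimal if it is not a proper refinement of any other $c$-partition of $G$. The minmin coalition number $c_{\min}(G)$ is the minimum number of sets in a minimal $c$-partition of $G$. *)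

theory Defs
  imports
    Graph_Theory.Pair_Digraph
    "HOL-Library.Disjoint_Sets"
    "HOL-Computational_Algebra.Polynomial"
begin

section \<open>Coalition partitions\<close>

text \<open>
  Finite simple undirected graphs are those satisfying \<^locale>\<open>pair_graph\<close>: finite,
  loop-free, with a symmetric arc relation \<^const>\<open>parcs\<close>. Thus \<open>u\<close> and \<open>v\<close> are
  adjacent iff \<open>(u, v) \<in> parcs G\<close>. Since \<^locale>\<open>pair_graph\<close> admits the empty graph,
  nonemptiness of \<^const>\<open>pverts\<close> has to be assumed separately.
\<close>

definition universal_vertex :: "'a pair_pre_digraph \<Rightarrow> 'a \<Rightarrow> bool" where
  "universal_vertex G v \<longleftrightarrow> v \<in> pverts G \<and> (\<forall>u \<in> pverts G - {v}. (u, v) \<in> parcs G)"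

definition dominating_set :: "'a pair_pre_digraph \<Rightarrow> 'a set \<Rightarrow> bool" where
  "dominating_set G S \<longleftrightarrow>
     S \<subseteq> pverts G \<and> (\<forall>v \<in> pverts G - S. \<exists>u \<in> S. (u, v) \<in> parcs G)"

definition coalition :: "'a pair_pre_digraph \<Rightarrow> 'a set \<Rightarrow> 'a set \<Rightarrow> bool" where
  "coalition G X Y \<longleftrightarrow>
     X \<subseteq> pverts G \<and> Y \<subseteq> pverts G \<and> X \<inter> Y = {} \<and>
     \<not> dominating_set G X \<and> \<not> dominating_set G Y \<and> dominating_set G (X \<union> Y)"

definition c_partition :: "'a pair_pre_digraph \<Rightarrow> 'a set set \<Rightarrow> bool" where
  "c_partition G P \<longleftrightarrow>
     partition_on (pverts G) P \<and>
     (\<forall>X \<in> P. (dominating_set G X \<and> card X = 1) \<or> (\<exists>Y \<in> P. Y \<noteq> X \<and> coalition G X Y))"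

text \<open>In \<^term>\<open>refines A P Q\<close> the finer partition is \<open>P\<close>.\<close>

definition minimal_c_partition :: "'a pair_pre_digraph \<Rightarrow> 'a set set \<Rightarrow> bool" where
  "minimal_c_partition G P \<longleftrightarrow>
     c_partition G P \<and> \<not> (\<exists>Q. c_partition G Q \<and> refines (pverts G) P Q \<and> P \<noteq> Q)"

text \<open>
  Every finite nonempty graph has a \<open>c\<close>-partition, so the minimum below is over a nonempty set.
\<close>

definition c_min :: "'a pair_pre_digraph \<Rightarrow> nat" where
  "c_min G = Min {card P |P. minimal_c_partition G P}"


section \<open>Polynomial-time computation\<close>

text \<open>
  The model is the deterministic multi-tape Turing machine with two-way infinite tapes.
  States and tape symbols are initial segments of the natural numbers; only the restriction of
  the transition function to these finite ranges (and to lists of one symbol per tape) matters,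
  by well-formedness below.
\<close>

datatype move = Move_Left | Stay | Move_Right

record turing_machine =
  tape_count :: nat
  state_count :: nat
  symbol_count :: nat
  delta :: "nat \<Rightarrow> nat list \<Rightarrow> nat \<times> (nat \<times> move) list"

abbreviation (input) start_state :: nat where "start_state \<equiv> 0"
abbreviation (input) accept_state :: nat where "accept_state \<equiv> 1"
abbreviation (input) reject_state :: nat where "reject_state \<equiv> 2"

abbreviation (input) blank :: nat where "blank \<equiv> 0"
abbreviation (input) bit0 :: nat where "bit0 \<equiv> 1"
abbreviation (input) bit1 :: nat where "bit1 \<equiv> 2"
abbreviation (input) separator :: nat where "separator \<equiv> 3"

definition wf_turing_machine :: "turing_machine \<Rightarrow> bool" where
  "wf_turing_machine M \<longleftrightarrow>
     tape_count M \<ge> 1 \<and>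
     {start_state, accept_state, reject_state} \<subseteq> {..<state_count M} \<and>
     {blank, bit0, bit1, separator} \<subseteq> {..<symbol_count M} \<and>
     (\<forall>q < state_count M. \<forall>ss.
        length ss = tape_count M \<and> set ss \<subseteq> {..<symbol_count M} \<longrightarrow>
        (case delta M q ss of (q', acts) \<Rightarrow>
           q' < state_count M \<and> length acts = tape_count M \<and>
           fst ` set acts \<subseteq> {..<symbol_count M}))"

text \<open>A tape is its content together with the head position.\<close>

type_synonym tape = "(int \<Rightarrow> nat) \<times> int"
type_synonym configuration = "nat \<times> tape list"

fun read_tape :: "tape \<Rightarrow> nat" where
  "read_tape (f, i) = f i"

fun move_offset :: "move \<Rightarrow> int" where
  "move_offset Move_Left = -1"
| "move_offset Stay = 0"
| "move_offset Move_Right = 1"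

fun act_on_tape :: "nat \<times> move \<Rightarrow> tape \<Rightarrow> tape" where
  "act_on_tape (s, m) (f, i) = (f(i := s), i + move_offset m)"

fun tm_step :: "turing_machine \<Rightarrow> configuration \<Rightarrow> configuration" where
  "tm_step M (q, ts) =
     (if q = accept_state \<or> q = reject_state then (q, ts)
      else case delta M q (map read_tape ts) of
        (q', acts) \<Rightarrow> (q', map2 act_on_tape acts ts))"

definition input_tape :: "nat list \<Rightarrow> tape" where
  "input_tape w = (\<lambda>i. if 0 \<le> i \<and> i < int (length w) then w ! nat i else blank, 0)"

definition blank_tape :: tape where
  "blank_tape = (\<lambda>i. blank, 0)"

definition initial_configuration :: "turing_machine \<Rightarrow> nat list \<Rightarrow> configuration" where
  "initial_configuration M w =
     (start_state, input_tape w # replicate (tape_count M - 1) blank_tape)"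

definition decides_within :: "turing_machine \<Rightarrow> nat list \<Rightarrow> nat \<Rightarrow> bool \<Rightarrow> bool" where
  "decides_within M w t answer \<longleftrightarrow>
     fst ((tm_step M ^^ t) (initial_configuration M w)) =
       (if answer then accept_state else reject_state)"

text \<open>
  The set \<open>I\<close> of instances is a promise: nothing is required of \<open>M\<close> outside \<open>I\<close>. Halting
  configurations are fixed points of \<^const>\<open>tm_step\<close>, so it suffices to look at the
  configuration reached when the time bound expires.
\<close>

definition decides_in_poly_time ::
    "turing_machine \<Rightarrow> ('i \<Rightarrow> nat list) \<Rightarrow> 'i set \<Rightarrow> ('i \<Rightarrow> bool) \<Rightarrow> bool" where
  "decides_in_poly_time M enc I Q \<longleftrightarrow>
     (\<exists>p :: nat poly. \<forall>x \<in> I. decides_within M (enc x) (poly p (length (enc x))) (Q x))"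

text \<open>
  The adjacency matrix of \<open>G\<close> with respect to the enumeration \<open>vs\<close> of its vertices, written row
  by row with every row terminated by a separator. Its length is \<open>n * (n + 1)\<close> for \<open>n\<close> vertices.
\<close>

definition encode_graph :: "'a pair_pre_digraph \<times> 'a list \<Rightarrow> nat list" where
  "encode_graph = (\<lambda>(G, vs).
     concat (map (\<lambda>u. map (\<lambda>v. if (u, v) \<in> parcs G then bit1 else bit0) vs @ [separator]) vs))"

end

theory Submission
  imports Defs
begin

text \<open>
  In a graph without universal vertices no single vertex dominates, so every set of a
  \<open>c\<close>-partition needs a coalition partner. Hence the one-part partition is never a
  \<open>c\<close>-partition, a \<open>c\<close>-partition with two parts is automatically minimal, and
  \<open>c_min G = 2\<close> says exactly that \<open>pverts G\<close> splits into two sets neither of which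
  dominates. A set fails to dominate iff it misses some closed neighbourhood; so such a split
  exists iff two closed neighbourhoods are disjoint, that is, iff two vertices are at distance at
  least 3 (possibly infinite). One direction needs care: if there is no two-part
  \<open>c\<close>-partition, the minimum in \<open>c_min\<close> must still range over a nonempty set to be a number
  other than 2. Every graph considered here has a \<open>c\<close>-partition, by peeling off minimal
  dominating sets (\<open>coalition_partition_of_dominating_set\<close>), and a coarsest one is minimal.

  The machine tests the distance condition directly on the adjacency matrix: \<open>u\<close> and \<open>v\<close>
  qualify iff they are not adjacent and their rows have no common 1. The case \<open>u = v\<close>, in which
  the vertex is isolated, may be admitted: without universal vertices an isolated vertex is far
  from some other vertex. The diagonal therefore needs no special treatment.
  Three copies of the matrix serve as a three-headed read-only
  input. The third head walks once through all entries \<open>(i, j)\<close>; meanwhile the first head stands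
  at the start of row \<open>i\<close> and the second at the start of row \<open>j\<close>, so that no head ever has to
  find a position by counting. Each entry or end of row costs time linear in the input length,
  so the whole run is quadratic.
\<close>

section \<open>Graphs in which two parts suffice\<close>

lemma partition_on_Un:
  assumes "partition_on A P" "partition_on B Q" "A \<inter> B = {}"
  shows "partition_on (A \<union> B) (P \<union> Q)"
  using assms disjoint_union[of P Q] by (auto simp: partition_on_def)

lemma partition_on_pair:
  assumes "A \<noteq> {}" "B \<noteq> {}" "A \<inter> B = {}"
  shows "partition_on (A \<union> B) {A, B}"
  using assms by (auto simp: partition_on_def disjoint_def)

text \<open>
  For \<open>u \<noteq> v\<close> this is disjointness of the closed neighbourhoods, i.e. distance at least 3;
  a vertex is separated from itself iff it is isolated.
\<close>

definition separated :: "'a pair_pre_digraph \<Rightarrow> 'a \<Rightarrow> 'a \<Rightarrow> bool" where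
  "separated G u v \<longleftrightarrow>
     (u, v) \<notin> parcs G \<and> \<not> (\<exists>w \<in> pverts G. (u, w) \<in> parcs G \<and> (v, w) \<in> parcs G)"

locale graph_without_universal_vertex = pair_graph G for G :: "'a pair_pre_digraph" +
  assumes nonempty: "pverts G \<noteq> {}"
    and no_universal: "\<not> (\<exists>v. universal_vertex G v)"
begin

lemma arc_sym: "(u, v) \<in> parcs G \<Longrightarrow> (v, u) \<in> parcs G"
  using pair_sym_arcs by (simp add: symmetric_def sym_def)

text \<open>
  This excludes the first alternative in the definition of a \<open>c\<close>-partition throughout.
\<close>

lemma singleton_not_dominating:
  assumes "card X = 1"
  shows "\<not> dominating_set G X"
proof
  assume "dominating_set G X"
  moreover obtain v where "X = {v}"
    using assms by (metis card_1_singletonE)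
  ultimately have "universal_vertex G v"
    using arc_sym unfolding dominating_set_def universal_vertex_def by auto
  then show False using no_universal by blast
qed

text \<open>
  A minimal dominating set \<open>D \<subseteq> S\<close> splits into two coalition partners \<open>A\<close> and \<open>B\<close>: by
  minimality, no nonempty proper part of \<open>D\<close> dominates. If the rest \<open>R = S - D\<close> dominates, it is
  partitioned by induction. Otherwise \<open>R\<close> is a third part when it is a partner of \<open>A\<close>; when it is
  not, \<open>A \<union> R\<close> does not dominate and can replace \<open>A\<close> as the partner of \<open>B\<close>.
\<close>

lemma coalition_partition_of_dominating_set:
  assumes "dominating_set G S"
  shows "\<exists>P. partition_on S P \<and> (\<forall>X \<in> P. \<exists>Y \<in> P. Y \<noteq> X \<and> coalition G X Y)"
  using assms
proof (induction "card S" arbitrary: S rule: less_induct)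
  case less
  have SV: "S \<subseteq> pverts G"
    using less.prems by (simp add: dominating_set_def)
  then have finS: "finite S"
    using pair_finite_verts finite_subset by blast
  obtain D where D: "D \<subseteq> S" "dominating_set G D"
    and Dmin: "\<And>T. T \<subseteq> D \<Longrightarrow> dominating_set G T \<Longrightarrow> T = D"
  proof -
    have "finite {T. T \<subseteq> S \<and> dominating_set G T}" "S \<in> {T. T \<subseteq> S \<and> dominating_set G T}"
      using finS less.prems by auto
    from finite_has_minimal2[OF this] show ?thesis
      using that by (metis (no_types, lifting) mem_Collect_eq order.trans)
  qed
  have finD: "finite D" using D(1) finS finite_subset by blast
  have "D \<noteq> {}"
    using D(2) nonempty by (auto simp: dominating_set_def)
  then obtain x where x: "x \<in> D" by blast
  define A B R where "A = {x}" and "B = D - {x}" and "R = S - D"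
  \<comment> \<open>Both halves are nonempty because no single vertex dominates.\<close>
  have "D \<noteq> {x}"
    using singleton_not_dominating[of "{x}"] D(2) by auto
  then have ne: "A \<noteq> {}" "B \<noteq> {}" "A \<noteq> B" "B \<noteq> A" and disj: "A \<inter> B = {}" and AB: "A \<union> B = D"
    using x by (auto simp: A_def B_def)
  have ndA: "\<not> dominating_set G A"
    using singleton_not_dominating[of "{x}"] by (simp add: A_def)
  have ndB: "\<not> dominating_set G B"
    using Dmin[of B] x by (auto simp: B_def)
  have coal: "coalition G A B" "coalition G B A"
    using ndA ndB disj AB D SV unfolding coalition_def by (auto simp: Un_commute)
  have partAB: "partition_on D {A, B}"
    using partition_on_pair[OF ne(1,2) disj] AB by simp
  have SD: "S = D \<union> R" "D \<inter> R = {}" using D(1) by (auto simp: R_def)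
  show ?case
  proof (cases "dominating_set G R")
    case True
    have "card R < card S"
      using finS x D(1) by (intro psubset_card_mono) (auto simp: R_def)
    with less.hyps True obtain P where P: "partition_on R P"
      "\<forall>X \<in> P. \<exists>Y \<in> P. Y \<noteq> X \<and> coalition G X Y" by blast
    have "partition_on S ({A, B} \<union> P)"
      using partition_on_Un[OF partAB P(1)] SD by simp
    moreover have "\<forall>X \<in> {A, B} \<union> P. \<exists>Y \<in> {A, B} \<union> P. Y \<noteq> X \<and> coalition G X Y"
      using P(2) coal ne by auto
    ultimately show ?thesis by blast
  next
    case ndR: False
    show ?thesis
    proof (cases "R = {} \<or> dominating_set G (A \<union> R)")
      case True
      then consider "R = {}" | "R \<noteq> {}" "dominating_set G (A \<union> R)" by blast
      then show ?thesis
      proof cases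
        case 1
        then show ?thesis using partAB SD coal ne by (intro exI[of _ "{A, B}"]) auto
      next
        case 2
        have "A \<inter> R = {}" "B \<inter> R = {}" using AB SD by auto
        then have "partition_on S {A, B, R}"
          using partition_on_Un[OF partAB partition_on_space[OF 2(1)]] SD
          by (simp add: insert_commute)
        moreover have "coalition G R A"
          using ndA ndR 2 \<open>A \<inter> R = {}\<close> SV SD AB unfolding coalition_def
          by (auto simp: Un_commute)
        moreover have "A \<noteq> R" using \<open>A \<inter> R = {}\<close> ne by auto
        ultimately show ?thesis using coal ne by (intro exI[of _ "{A, B, R}"]) auto
      qed
    next
      case False
      have AR: "(A \<union> R) \<inter> B = {}" "A \<union> R \<noteq> {}" "(A \<union> R) \<union> B = S"
        using AB SD disj ne by auto
      then have "partition_on S {A \<union> R, B}"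
        using partition_on_pair[of "A \<union> R" B] ne by simp
      moreover have "coalition G (A \<union> R) B"
        using AR False ndB less.prems SV by (auto simp: coalition_def)
      moreover from this have "coalition G B (A \<union> R)"
        by (simp add: coalition_def Int_commute Un_commute)
      moreover have "A \<union> R \<noteq> B" using AR ne by blast
      ultimately show ?thesis by (intro exI[of _ "{A \<union> R, B}"]) auto
    qed
  qed
qed

lemma c_partition_exists: "\<exists>P. c_partition G P"
  using coalition_partition_of_dominating_set[of "pverts G"]
  by (auto simp: c_partition_def dominating_set_def)

text \<open>
  Refinement is a partial order on the finitely many partitions, so a coarsest \<open>c\<close>-partition
  exists. The number of partitions refining \<open>P\<close> is used as a rank that grows strictly under
  proper coarsening.
\<close>

lemma minimal_c_partition_exists: "\<exists>P. minimal_c_partition G P"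
proof -
  obtain P\<^sub>0 where P\<^sub>0: "c_partition G P\<^sub>0" using c_partition_exists by blast
  let ?V = "pverts G"
  define rank where "rank P = card {R. refines ?V R P}" for P
  have fin: "finite {R. partition_on ?V R}"
    using finitely_many_partition_on[OF pair_finite_verts] by simp
  have sub: "{R. refines ?V R P} \<subseteq> {R. partition_on ?V R}" for P
    by (auto simp: refines_def)
  have "rank P < Suc (card {R. partition_on ?V R})" for P
    unfolding rank_def using card_mono[OF fin sub] by (simp add: less_Suc_eq_le)
  then obtain P where P: "c_partition G P" "\<And>Q. c_partition G Q \<Longrightarrow> rank Q \<le> rank P"
    using ex_has_greatest_nat[of "c_partition G" P\<^sub>0 rank, OF P\<^sub>0] by metis
  have "\<not> (c_partition G Q \<and> refines ?V P Q \<and> P \<noteq> Q)" for Q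
  proof
    assume Q: "c_partition G Q \<and> refines ?V P Q \<and> P \<noteq> Q"
    have "{R. refines ?V R P} \<subset> {R. refines ?V R Q}"
    proof
      show "{R. refines ?V R P} \<subseteq> {R. refines ?V R Q}"
        using Q refines_trans by blast
      have "refines ?V Q Q" "\<not> refines ?V Q P"
        using Q refines_asym[of ?V P Q] by (auto simp: refines_def)
      then show "{R. refines ?V R P} \<noteq> {R. refines ?V R Q}" by blast
    qed
    then have "rank P < rank Q"
      unfolding rank_def using finite_subset[OF sub fin] psubset_card_mono by blast
    then show False using P(2)[of Q] Q by simp
  qed
  then show ?thesis using P(1) unfolding minimal_c_partition_def by blast
qed

lemma trivial_partition_not_c_partition: "\<not> c_partition G {X}"
  using singleton_not_dominating unfolding c_partition_def by auto

lemma two_part_c_partition_iff: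
  assumes "A \<noteq> B" "partition_on (pverts G) {A, B}"
  shows "c_partition G {A, B} \<longleftrightarrow> \<not> dominating_set G A \<and> \<not> dominating_set G B"
proof -
  have "A \<union> B = pverts G" "A \<inter> B = {}"
    using assms by (auto simp: partition_on_def disjoint_def)
  moreover from this have "dominating_set G (A \<union> B)" by (simp add: dominating_set_def)
  ultimately show ?thesis
    using assms singleton_not_dominating
    unfolding c_partition_def coalition_def by (auto simp: Un_commute)
qed

text \<open>
  A partition properly coarser than a two-part one has a single part and is no \<open>c\<close>-partition.
  So two-part \<open>c\<close>-partitions are minimal, and they attain the smallest conceivable size.
\<close>

lemma c_min_eq_2_iff_two_part_c_partition:
  "c_min G = 2 \<longleftrightarrow> (\<exists>P. c_partition G P \<and> card P = 2)"
proof -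
  let ?C = "{card P |P. minimal_c_partition G P}"
  have finP: "finite P" if "c_partition G P" for P
    using that pair_finite_verts finite_elements unfolding c_partition_def by blast
  have ge2: "card P \<ge> 2" if "c_partition G P" for P
  proof -
    have "P \<noteq> {}" using that nonempty by (auto simp: c_partition_def partition_on_def)
    moreover have "card P \<noteq> 1"
      using that trivial_partition_not_c_partition by (metis card_1_singletonE)
    ultimately show ?thesis
      using finP[OF that] by (metis card_0_eq less_2_cases not_less One_nat_def)
  qed
  have "?C \<subseteq> card ` {P. partition_on (pverts G) P}"
    by (auto simp: minimal_c_partition_def c_partition_def)
  then have finC: "finite ?C"
    using finitely_many_partition_on[OF pair_finite_verts] finite_surj by blast
  have neC: "?C \<noteq> {}"
    using minimal_c_partition_exists by blast
  have minimal: "minimal_c_partition G P" if P: "c_partition G P" "card P = 2" for P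
  proof -
    have False if Q: "c_partition G Q" "refines (pverts G) P Q" "P \<noteq> Q" for Q
    proof -
      obtain A B where AB: "P = {A, B}" "A \<noteq> B" using P(2) by (meson card_2_iff)
      have "\<forall>X \<in> {A, B}. \<exists>Y \<in> Q. X \<subseteq> Y" using Q(2) AB(1) by (simp add: refines_def)
      then obtain A' B' where A': "A' \<in> Q" "A \<subseteq> A'" and B': "B' \<in> Q" "B \<subseteq> B'" by auto
      have pQ: "partition_on (pverts G) Q" and pP: "partition_on (pverts G) P"
        using Q(2) by (auto simp: refines_def)
      have "A \<union> B = pverts G" using pP AB(1) by (auto simp: partition_on_def)
      have "X = A' \<or> X = B'" if "X \<in> Q" for X
      proof (rule ccontr)
        assume "\<not> ?thesis"
        then have "X \<inter> A' = {}" "X \<inter> B' = {}"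
          using pQ that A' B' by (auto simp: partition_on_def disjoint_def)
        moreover have "X \<subseteq> A \<union> B" "X \<noteq> {}"
          using pQ that \<open>A \<union> B = pverts G\<close> by (auto simp: partition_on_def)
        ultimately show False using A' B' by blast
      qed
      then have QAB: "Q = {A', B'}" using A' B' by blast
      show False
      proof (cases "A' = B'")
        case True
        then show False using QAB Q(1) trivial_partition_not_c_partition by auto
      next
        case False
        then have "A' \<inter> B' = {}" "A' \<union> B' = A \<union> B"
          using pQ QAB \<open>A \<union> B = pverts G\<close> by (auto simp: partition_on_def disjoint_def)
        then have "A' = A" "B' = B" using A' B' by blast+
        then show False using QAB AB Q(3) by simp
      qed
    qed
    then show ?thesis using P(1) unfolding minimal_c_partition_def by blast
  qed
  show ?thesis
  proof
    assume "c_min G = 2"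
    then have "2 \<in> ?C" using Min_in[OF finC neC] by (simp add: c_min_def)
    then show "\<exists>P. c_partition G P \<and> card P = 2"
      by (auto simp: minimal_c_partition_def)
  next
    assume "\<exists>P. c_partition G P \<and> card P = 2"
    then have "2 \<in> ?C" using minimal by force
    moreover have "\<forall>k \<in> ?C. 2 \<le> k" using ge2 by (auto simp: minimal_c_partition_def)
    ultimately show "c_min G = 2"
      unfolding c_min_def using finC by (intro Min_eqI) auto
  qed
qed

text \<open>
  If \<open>A\<close> does not dominate \<open>u\<close>, and its complement \<open>B\<close> does not dominate \<open>v\<close>, then the
  closed neighbourhood of \<open>u\<close> lies in \<open>B\<close> and that of \<open>v\<close> lies in \<open>A\<close>. Conversely, the
  closed neighbourhood of \<open>u\<close> and its complement are such a pair if \<open>v \<noteq> u\<close> is separated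
  from \<open>u\<close>.
\<close>

lemma two_part_c_partition_iff_separated:
  "(\<exists>P. c_partition G P \<and> card P = 2) \<longleftrightarrow>
    (\<exists>u \<in> pverts G. \<exists>v \<in> pverts G. separated G u v)"
proof
  assume "\<exists>P. c_partition G P \<and> card P = 2"
  then obtain A B where cAB: "c_partition G {A, B}" and ne: "A \<noteq> B" by (auto simp: card_2_iff)
  then have p: "partition_on (pverts G) {A, B}" by (simp add: c_partition_def)
  have AB: "A \<union> B = pverts G" "A \<inter> B = {}"
    using p ne by (auto simp: partition_on_def disjoint_def)
  have nd: "\<not> dominating_set G A" "\<not> dominating_set G B"
    using two_part_c_partition_iff[OF ne p] cAB by auto
  obtain u where u: "u \<in> B" "\<And>w. w \<in> A \<Longrightarrow> (w, u) \<notin> parcs G"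
    using nd(1) AB unfolding dominating_set_def by auto
  obtain v where v: "v \<in> A" "\<And>w. w \<in> B \<Longrightarrow> (w, v) \<notin> parcs G"
    using nd(2) AB unfolding dominating_set_def by auto
  have "separated G u v"
    unfolding separated_def using u v AB arc_sym by blast
  then show "\<exists>u \<in> pverts G. \<exists>v \<in> pverts G. separated G u v"
    using u(1) v(1) AB by blast
next
  assume "\<exists>u \<in> pverts G. \<exists>v \<in> pverts G. separated G u v"
  then obtain u v\<^sub>0 where u: "u \<in> pverts G" and v\<^sub>0: "v\<^sub>0 \<in> pverts G" "separated G u v\<^sub>0" by blast
  obtain v where v: "v \<in> pverts G" "v \<noteq> u" "separated G u v"
  proof (cases "v\<^sub>0 = u")
    case True
    \<comment> \<open>A vertex separated from itself is isolated, hence separated from every other vertex.\<close>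
    then have iso: "(u, w) \<notin> parcs G" for w
      using v\<^sub>0(2) in_arcsD2 unfolding separated_def by blast
    obtain v where "v \<in> pverts G" "v \<noteq> u"
      using no_universal u unfolding universal_vertex_def by blast
    then show ?thesis using that iso unfolding separated_def by blast
  next
    case False
    then show ?thesis using that v\<^sub>0 by blast
  qed
  define B where "B = {w \<in> pverts G. w = u \<or> (u, w) \<in> parcs G}"
  define A where "A = pverts G - B"
  have "u \<in> B" "u \<notin> A" "v \<in> A" "v \<notin> B"
    using u v by (auto simp: A_def B_def separated_def)
  then have ne: "A \<noteq> B" and p: "partition_on (pverts G) {A, B}"
    by (auto simp: partition_on_def disjoint_def A_def B_def)
  have "\<not> dominating_set G A"
    using u \<open>u \<notin> A\<close> arc_sym unfolding dominating_set_def A_def B_def by blast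
  moreover have "\<not> dominating_set G B"
    using v \<open>v \<notin> B\<close> arc_sym unfolding dominating_set_def B_def separated_def by blast
  ultimately have "c_partition G {A, B}"
    using two_part_c_partition_iff[OF ne p] by blast
  then show "\<exists>P. c_partition G P \<and> card P = 2" using ne by (intro exI[of _ "{A, B}"]) simp
qed

end

section \<open>A machine that looks for separated vertices\<close>

text \<open>
  Control states. In the state \<open>choosing\<close> the third head reads the next matrix entry
  \<open>(i, j)\<close>. The rows \<open>i\<close> and \<open>j\<close> are then compared in \<open>comparing_free\<close> or
  \<open>comparing_hit\<close>; a hit is an adjacency of the two vertices or a common neighbour. After a hit,
  \<open>returning\<close> brings the first head back to the start of row \<open>i\<close>, while the second is already
  at the start of row \<open>j + 1\<close>. At the end of a row, \<open>advancing\<close> moves the first head to row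
  \<open>i + 1\<close> and \<open>resetting\<close> moves the second back to row 0.
\<close>

abbreviation (input) rewinding :: nat where "rewinding \<equiv> 3"
abbreviation (input) choosing :: nat where "choosing \<equiv> 4"
abbreviation (input) comparing_free :: nat where "comparing_free \<equiv> 5"
abbreviation (input) comparing_hit :: nat where "comparing_hit \<equiv> 6"
abbreviation (input) returning :: nat where "returning \<equiv> 7"
abbreviation (input) advancing :: nat where "advancing \<equiv> 8"
abbreviation (input) resetting :: nat where "resetting \<equiv> 9"

text \<open>
  The transition table after the copying phase, as a function of the state and the three
  symbols read. No symbol is ever overwritten, so only the head moves are given. The final
  branch is the state \<open>resetting\<close>.
\<close>

definition scan :: "nat \<Rightarrow> nat \<Rightarrow> nat \<Rightarrow> nat \<Rightarrow> nat \<times> move list" where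
  "scan q a b c =
    (if q = rewinding then
       if a = blank then (choosing, [Move_Right, Move_Right, Move_Right])
       else (rewinding, [Move_Left, Move_Left, Move_Left])
     else if q = choosing then
       if c = blank then (reject_state, [Stay, Stay, Stay])
       else if c = separator then (advancing, [Stay, Stay, Move_Right])
       else if c = bit1 then (comparing_hit, [Stay, Stay, Move_Right])
       else (comparing_free, [Stay, Stay, Move_Right])
     else if q = comparing_free \<or> q = comparing_hit then
       if a = separator then
         if q = comparing_free then (accept_state, [Stay, Stay, Stay])
         else (returning, [Move_Left, Move_Right, Stay])
       else (if a = bit1 \<and> b = bit1 then comparing_hit else q, [Move_Right, Move_Right, Stay])
     else if q = returning then
       if a = separator \<or> a = blank then (choosing, [Move_Right, Stay, Stay])
       else (returning, [Move_Left, Stay, Stay])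
     else if q = advancing then
       if a = separator then (resetting, [Move_Right, Move_Left, Stay])
       else (advancing, [Move_Right, Stay, Stay])
     else
       if b = blank then (choosing, [Stay, Move_Right, Stay])
       else (resetting, [Stay, Move_Left, Stay]))"

text \<open>
  The start state copies the input to the other two tapes. While it runs all heads have the same
  position, which is why \<open>rewinding\<close> can look at the first tape only.
\<close>

definition separation_machine :: turing_machine where
  "separation_machine =
    \<lparr>tape_count = 3, state_count = 10, symbol_count = 4,
     delta = (\<lambda>q ss.
       if q = start_state then
         if ss ! 0 = blank then (rewinding, map (\<lambda>s. (s, Move_Left)) ss)
         else (start_state, replicate 3 (ss ! 0, Move_Right))
       else (case scan q (ss ! 0) (ss ! 1) (ss ! 2) of (q', ms) \<Rightarrow> (q', zip ss ms)))\<rparr>"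

lemma wf_separation_machine: "wf_turing_machine separation_machine"
proof -
  have "fst (scan q a b c) < 10 \<and> length (snd (scan q a b c)) = 3" if "q < 10" for q a b c
    using that by (simp add: scan_def)
  moreover have "ss ! 0 < 4" if "length ss = 3" "set ss \<subseteq> {..<4}" for ss :: "nat list"
    using that nth_mem[of 0 ss] by (metis lessThan_iff subsetD zero_less_numeral)
  moreover have "s < 4" if "set ss \<subseteq> {..<4}" "(s, m) \<in> set (zip ss ms)"
    for s :: nat and ss and m :: move and ms
    using that set_zip_leftD by fastforce
  ultimately show ?thesis
    by (fastforce simp: wf_turing_machine_def separation_machine_def case_prod_beta)
qed

abbreviation step :: "configuration \<Rightarrow> configuration" where
  "step \<equiv> tm_step separation_machine"

text \<open>
  After copying, all tapes carry the same content \<open>F\<close>, and \<open>a\<close>, \<open>b\<close>, \<open>c\<close> are the head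
  positions.
\<close>

definition scan_config :: "(int \<Rightarrow> nat) \<Rightarrow> nat \<Rightarrow> int \<Rightarrow> int \<Rightarrow> int \<Rightarrow> configuration" where
  "scan_config F q a b c = (q, [(F, a), (F, b), (F, c)])"

lemma step_scan_config:
  assumes "q \<notin> {start_state, accept_state, reject_state}"
    and "scan q (F a) (F b) (F c) = (q', [l, m, r])"
  shows "step (scan_config F q a b c) =
    scan_config F q' (a + move_offset l) (b + move_offset m) (c + move_offset r)"
  using assms by (simp add: scan_config_def separation_machine_def)

text \<open>
  Every loop of the machine is treated by writing down the configuration \<open>X k\<close> after \<open>k\<close>
  rounds in closed form.
\<close>

lemma iterate_along:
  assumes "\<And>k. k < d \<Longrightarrow> f (X k) = X (Suc k)"
  shows "(f ^^ d) (X 0) = X d"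
  using assms by (induction d) auto

definition halts_within :: "nat \<Rightarrow> configuration \<Rightarrow> bool \<Rightarrow> bool" where
  "halts_within t x answer \<longleftrightarrow>
     fst ((step ^^ t) x) = (if answer then accept_state else reject_state)"

text \<open>
  Halting configurations are fixed points, so an exact running time may be replaced by any upper
  bound.
\<close>

lemma halts_within_mono:
  assumes "halts_within s x answer" "s \<le> t"
  shows "halts_within t x answer"
proof -
  have fixed: "(step ^^ k) y = y" if "fst y = accept_state \<or> fst y = reject_state" for k y
  proof -
    have "step y = y" using that by (cases y) auto
    then show ?thesis by (induction k) auto
  qed
  have "(step ^^ t) x = (step ^^ (t - s)) ((step ^^ s) x)"
    using assms(2) by (metis funpow_add comp_apply le_add_diff_inverse2)
  also have "\<dots> = (step ^^ s) x"
    using assms(1) by (intro fixed) (simp add: halts_within_def split: if_splits)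
  finally show ?thesis using assms(1) by (simp add: halts_within_def)
qed

lemma halts_within_funpow:
  assumes "(step ^^ s) x = y" "halts_within t y answer"
  shows "halts_within (s + t) x answer"
  using assms by (simp add: halts_within_def funpow_add add.commute[of s])

text \<open>
  A tape holding an \<open>n \<times> n\<close> matrix with a separator after each row: entry \<open>(i, j)\<close> is at
  position \<open>i * Suc n + j\<close>, and \<open>j = n\<close> is the separator. The blanks at both ends are what the
  moving heads stop at.
\<close>

locale matrix_tape =
  fixes F :: "int \<Rightarrow> nat" and n :: nat and adj :: "nat \<Rightarrow> nat \<Rightarrow> bool"
  assumes entry: "i < n \<Longrightarrow> j < n \<Longrightarrow>
      F (int (i * Suc n + j)) = (if adj i j then bit1 else bit0)"
    and row_end: "i < n \<Longrightarrow> F (int (i * Suc n + n)) = separator"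
    and before: "F (-1) = blank"
    and after: "F (int (n * Suc n)) = blank"
begin

definition separated_rows :: "nat \<Rightarrow> nat \<Rightarrow> bool" where
  "separated_rows i j \<longleftrightarrow> \<not> adj i j \<and> \<not> (\<exists>l < n. adj i l \<and> adj j l)"

text \<open>
  The main loop passes through these configurations, where \<open>j = n\<close> stands for the end of
  row \<open>i\<close>.
\<close>

definition choose_entry :: "nat \<Rightarrow> nat \<Rightarrow> configuration" where
  "choose_entry i j =
     scan_config F choosing (int (i * Suc n)) (int (j * Suc n)) (int (i * Suc n + j))"

lemma nonblank: "p < n * Suc n \<Longrightarrow> F (int p) \<noteq> blank"
proof -
  assume p: "p < n * Suc n"
  have "p div Suc n < n" using p by (simp add: less_mult_imp_div_less)
  moreover have "p mod Suc n < n \<or> p mod Suc n = n"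
    using mod_less_divisor[of "Suc n" p] by linarith
  ultimately show ?thesis
    using entry[of "p div Suc n" "p mod Suc n"] row_end[of "p div Suc n"]
    by (metis div_mult_mod_eq zero_neq_numeral zero_neq_one)
qed

lemma compare_rows:
  assumes "i < n" "j < n" "q \<in> {comparing_free, comparing_hit}"
  shows "(step ^^ n) (scan_config F q (int (i * Suc n)) (int (j * Suc n)) c) =
    scan_config F
      (if q = comparing_hit \<or> (\<exists>l < n. adj i l \<and> adj j l) then comparing_hit else comparing_free)
      (int (i * Suc n + n)) (int (j * Suc n + n)) c"
proof -
  define X where "X k = scan_config F
      (if q = comparing_hit \<or> (\<exists>l < k. adj i l \<and> adj j l) then comparing_hit else comparing_free)
      (int (i * Suc n + k)) (int (j * Suc n + k)) c" for k
  have "step (X k) = X (Suc k)" if k: "k < n" for k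
  proof -
    define p where "p = (if q = comparing_hit \<or> (\<exists>l < k. adj i l \<and> adj j l)
      then comparing_hit else comparing_free)"
    define p' where "p' = (if adj i k \<and> adj j k then comparing_hit else p)"
    have p: "p \<in> {comparing_free, comparing_hit}" by (simp add: p_def)
    have "scan p (F (int (i * Suc n + k))) (F (int (j * Suc n + k))) (F c) =
        (p', [Move_Right, Move_Right, Stay])"
      using p k assms by (auto simp: scan_def entry p'_def simp del: mult_Suc_right of_nat_add)
    moreover have "p' = (if q = comparing_hit \<or> (\<exists>l < Suc k. adj i l \<and> adj j l)
        then comparing_hit else comparing_free)"
      by (auto simp: p_def p'_def less_Suc_eq)
    ultimately show ?thesis
      using p unfolding X_def p_def[symmetric]
      by (subst step_scan_config) (auto simp: algebra_simps)
  qed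
  from iterate_along[of n step X, OF this] show ?thesis
    using assms(3) by (auto simp: X_def)
qed

text \<open>
  The head stops on the separator of the previous row, or on the blank at position \<open>-1\<close> if
  \<open>i = 0\<close>.
\<close>

lemma return_to_row_start:
  assumes "i < n"
  shows "(step ^^ Suc n) (scan_config F returning (int (i * Suc n + n) - 1) b c) =
    scan_config F choosing (int (i * Suc n)) b c"
proof -
  define X where "X k = scan_config F returning (int (i * Suc n + n) - 1 - int k) b c" for k
  have "step (X k) = X (Suc k)" if k: "k < n" for k
  proof -
    have pos: "int (i * Suc n + n) - 1 - int k = int (i * Suc n + (n - Suc k))"
      using k by (simp add: of_nat_diff)
    have "F (int (i * Suc n + n) - 1 - int k) \<in> {bit0, bit1}"
      unfolding pos by (subst entry) (use assms k in auto)
    then show ?thesis unfolding X_def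
      by (subst step_scan_config[where l = Move_Left and m = Stay and r = Stay])
        (auto simp: scan_def)
  qed
  then have "(step ^^ n) (X 0) = X n" by (rule iterate_along)
  moreover have "step (X n) = scan_config F choosing (int (i * Suc n)) b c"
  proof -
    have "F (int (i * Suc n) - 1) \<in> {blank, separator}"
    proof (cases i)
      case 0
      then show ?thesis using before by simp
    next
      case (Suc i')
      then have "int (i * Suc n) - 1 = int (i' * Suc n + n)" by simp
      then show ?thesis using row_end[of i'] Suc assms by (metis Suc_lessD insertI1 insertI2)
    qed
    moreover have "X n = scan_config F returning (int (i * Suc n) - 1) b c"
      by (simp add: X_def algebra_simps)
    ultimately show ?thesis
      by (auto simp: step_scan_config[where l = Move_Right and m = Stay and r = Stay]
          scan_def simp del: mult_Suc_right of_nat_mult)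
  qed
  ultimately show ?thesis by (simp add: X_def)
qed

lemma advance_to_next_row:
  assumes "i < n"
  shows "(step ^^ Suc n) (scan_config F advancing (int (i * Suc n)) b c) =
    scan_config F resetting (int (Suc i * Suc n)) (b - 1) c"
proof -
  define X where "X k = scan_config F advancing (int (i * Suc n + k)) b c" for k
  have "step (X k) = X (Suc k)" if k: "k < n" for k
    unfolding X_def using entry[OF assms k]
    by (subst step_scan_config[where l = Move_Right and m = Stay and r = Stay])
      (auto simp: scan_def algebra_simps)
  then have "(step ^^ n) (X 0) = X n" by (rule iterate_along)
  moreover have "step (X n) = scan_config F resetting (int (Suc i * Suc n)) (b - 1) c"
    unfolding X_def using row_end[OF assms]
    by (subst step_scan_config[where l = Move_Right and m = Move_Left and r = Stay])
      (auto simp: scan_def algebra_simps)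
  ultimately show ?thesis by (simp add: X_def)
qed

text \<open>
  After all \<open>n\<close> rows the second head is on the blank behind the matrix; \<open>advancing\<close> has already
  moved it one cell to the left.
\<close>

lemma reset_second_head:
  "(step ^^ Suc (n * Suc n)) (scan_config F resetting a (int (n * Suc n) - 1) c) =
    scan_config F choosing a 0 c"
proof -
  define X where "X k = scan_config F resetting a (int (n * Suc n) - 1 - int k) c" for k
  have "step (X k) = X (Suc k)" if k: "k < n * Suc n" for k
  proof -
    have pos: "int (n * Suc n) - 1 - int k = int (n * Suc n - Suc k)"
      using k by (simp only: of_nat_diff Suc_leI)
    have "F (int (n * Suc n) - 1 - int k) \<noteq> blank"
      unfolding pos by (rule nonblank) (use k in linarith)
    then show ?thesis unfolding X_def
      by (subst step_scan_config[where l = Stay and m = Move_Left and r = Stay])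
        (auto simp: scan_def)
  qed
  then have "(step ^^ (n * Suc n)) (X 0) = X (n * Suc n)" by (rule iterate_along)
  moreover have "step (X (n * Suc n)) = scan_config F choosing a 0 c"
    unfolding X_def using before
    by (subst step_scan_config[where l = Stay and m = Move_Right and r = Stay])
      (auto simp: scan_def)
  ultimately show ?thesis by (simp add: X_def)
qed

lemma treat_entry:
  assumes "i < n" "j < n"
  shows "(step ^^ (n + 2)) (choose_entry i j) =
    (if separated_rows i j
     then scan_config F accept_state (int (i * Suc n + n)) (int (j * Suc n + n)) (int (i * Suc n + Suc j))
     else scan_config F returning (int (i * Suc n + n) - 1) (int (Suc j * Suc n)) (int (i * Suc n + Suc j)))"
proof -
  let ?c = "int (i * Suc n + Suc j)"
  \<comment> \<open>The entry itself counts as a hit, so adjacent vertices are never accepted.\<close>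
  define q where "q = (if adj i j then comparing_hit else comparing_free)"
  define q' where "q' = (if separated_rows i j then comparing_free else comparing_hit)"
  have "step (choose_entry i j) = scan_config F q (int (i * Suc n)) (int (j * Suc n)) ?c"
    unfolding choose_entry_def using entry[OF assms]
    by (subst step_scan_config[where q' = q and l = Stay and m = Stay and r = Move_Right])
      (auto simp: scan_def q_def algebra_simps)
  moreover have "(step ^^ n) (scan_config F q (int (i * Suc n)) (int (j * Suc n)) ?c) =
      scan_config F q' (int (i * Suc n + n)) (int (j * Suc n + n)) ?c"
    using compare_rows[OF assms, of q ?c]
    by (auto simp: q_def q'_def separated_rows_def)
  moreover have "step (scan_config F q' (int (i * Suc n + n)) (int (j * Suc n + n)) ?c) =
    (if separated_rows i j
     then scan_config F accept_state (int (i * Suc n + n)) (int (j * Suc n + n)) ?c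
     else scan_config F returning (int (i * Suc n + n) - 1) (int (Suc j * Suc n)) ?c)"
    using row_end[OF assms(1)]
    by (auto simp: scan_config_def separation_machine_def scan_def q'_def simp del: of_nat_add)
  moreover have "step ^^ (n + 2) = step \<circ> (step ^^ n) \<circ> step"
    by (simp add: funpow_swap1 comp_def fun_eq_iff)
  ultimately show ?thesis by simp
qed

lemma next_entry:
  assumes "i < n" "j < n" "\<not> separated_rows i j"
  shows "(step ^^ (2 * n + 3)) (choose_entry i j) = choose_entry i (Suc j)"
proof -
  have "2 * n + 3 = Suc n + (n + 2)" by simp
  then show ?thesis
    using treat_entry[OF assms(1,2)] return_to_row_start[OF assms(1)] assms(3)
    by (simp only: funpow_add comp_apply choose_entry_def if_False)
qed

lemma next_row:
  assumes "i < n"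
  shows "(step ^^ (n * Suc n + n + 3)) (choose_entry i n) = choose_entry (Suc i) 0"
proof -
  let ?c = "int (Suc i * Suc n)"
  have "step (choose_entry i n) =
      scan_config F advancing (int (i * Suc n)) (int (n * Suc n)) ?c"
    unfolding choose_entry_def using row_end[OF assms]
    by (subst step_scan_config[where l = Stay and m = Stay and r = Move_Right])
      (auto simp: scan_def algebra_simps)
  moreover have "n * Suc n + n + 3 = Suc (n * Suc n) + (Suc n + 1)" "step ^^ 1 = step"
    by simp_all
  ultimately show ?thesis
    using advance_to_next_row[OF assms] reset_second_head
    by (simp only: funpow_add comp_apply choose_entry_def) simp
qed

lemma div_mod_of_position:
  assumes "j < Suc n"
  shows "(i * Suc n + j) div Suc n = i" "(i * Suc n + j) mod Suc n = j"
  using assms by (simp_all del: mult_Suc_right)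

text \<open>
  Correctness of the main loop, by downward induction on the position \<open>p\<close> of the third head:
  from there on, exactly the entries at positions \<open>\<ge> p\<close> are tested. Division by \<open>Suc n\<close> recovers
  row and column, so that entries and ends of rows are handled by the same induction.
  The factor \<open>2 * (n * Suc n) + 3\<close> bounds both the cost \<open>2 * n + 3\<close> of an entry and the cost
  \<open>n * Suc n + n + 3\<close> of an end of row.
\<close>

lemma choose_entry_decides:
  assumes "p \<le> n * Suc n"
  shows "halts_within ((n * Suc n - p) * (2 * (n * Suc n) + 3) + 1)
    (choose_entry (p div Suc n) (p mod Suc n))
    (\<exists>i < n. \<exists>j < n. p \<le> i * Suc n + j \<and> separated_rows i j)"
  using assms
proof (induction p rule: inc_induct)
  case base
  have "\<not> n * Suc n \<le> i * Suc n + j" if "i < n" "j < n" for i j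
  proof -
    have "Suc i * Suc n \<le> n * Suc n" using that by (intro mult_right_mono) auto
    then show ?thesis using that by simp
  qed
  moreover have "fst (step (choose_entry n 0)) = reject_state"
    using after by (simp add: choose_entry_def scan_config_def separation_machine_def scan_def)
  moreover have "n * Suc n div Suc n = n" "n * Suc n mod Suc n = 0"
    using div_mod_of_position[of 0 n] by simp_all
  ultimately show ?case by (auto simp: halts_within_def)
next
  case (step p)
  let ?L = "n * Suc n" and ?Q = "\<lambda>p. \<exists>i < n. \<exists>j < n. p \<le> i * Suc n + j \<and> separated_rows i j"
  define i j where "i = p div Suc n" and "j = p mod Suc n"
  have i: "i < n" using step by (simp add: i_def less_mult_imp_div_less)
  have j: "j \<le> n" unfolding j_def using mod_less_divisor[of "Suc n" p] by linarith
  have p: "p = i * Suc n + j" unfolding i_def j_def by (rule div_mult_mod_eq[symmetric])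
  have unique: "i' = i \<and> j' = j" if "p = i' * Suc n + j'" "j' < n" for i' j'
    using that div_mod_of_position[of j' i'] by (simp add: i_def j_def del: mult_Suc_right)
  have "?L - p = Suc (?L - Suc p)" using step by simp
  then have time: "(?L - p) * (2 * ?L + 3) + 1 = (2 * ?L + 3) + ((?L - Suc p) * (2 * ?L + 3) + 1)"
    by simp
  have continue: ?case
    if "(step ^^ s) (choose_entry i j) = choose_entry (Suc p div Suc n) (Suc p mod Suc n)"
      "s \<le> 2 * ?L + 3" "\<not> (j < n \<and> separated_rows i j)" for s
  proof -
    have "p \<le> i' * Suc n + j' \<longleftrightarrow> Suc p \<le> i' * Suc n + j'"
      if "j' < n" "separated_rows i' j'" for i' j'
    proof -
      have "p \<noteq> i' * Suc n + j'"
        using unique[of i' j'] that \<open>\<not> (j < n \<and> separated_rows i j)\<close> by metis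
      then show ?thesis by (metis Suc_leD Suc_leI le_neq_implies_less)
    qed
    then have Q: "?Q p \<longleftrightarrow> ?Q (Suc p)" by metis
    have "halts_within (s + ((?L - Suc p) * (2 * ?L + 3) + 1)) (choose_entry i j) (?Q p)"
      unfolding Q by (rule halts_within_funpow[OF that(1) step.IH])
    then show ?thesis
      unfolding i_def[symmetric] j_def[symmetric] time
      by (rule halts_within_mono) (use that(2) in simp)
  qed
  consider "j < n" "separated_rows i j" | "j < n" "\<not> separated_rows i j" | "j = n"
    using j by linarith
  then show ?case
  proof cases
    case 1
    then have "?Q p" using i p by blast
    moreover have "fst ((step ^^ (n + 2)) (choose_entry i j)) = accept_state"
      using treat_entry[OF i 1(1)] 1(2) by (simp add: scan_config_def)
    ultimately have "halts_within (n + 2) (choose_entry i j) (?Q p)"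
      by (simp add: halts_within_def)
    then show ?thesis
      unfolding i_def[symmetric] j_def[symmetric] time
      by (rule halts_within_mono) simp
  next
    case 2
    have "Suc p = i * Suc n + Suc j" using p by simp
    then have "Suc p div Suc n = i" "Suc p mod Suc n = Suc j"
      using div_mod_of_position[of "Suc j" i] 2(1) by (simp_all only: Suc_mono)
    then show ?thesis
      using continue[of "2 * n + 3"] next_entry[OF i 2] 2 by simp
  next
    case 3
    have "Suc p = Suc i * Suc n + 0" using 3 p by simp
    then have "Suc p div Suc n = Suc i" "Suc p mod Suc n = 0"
      using div_mod_of_position[of 0 "Suc i"] by (simp_all only: zero_less_Suc)
    then show ?thesis
      using continue[of "n * Suc n + n + 3"] next_row[OF i] 3 by simp
  qed
qed

end

text \<open>
  Copying and rewinding take \<open>length w + 1\<close> steps each, the extra step being the one on the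
  blank where the heads turn round.
\<close>

lemma copy_and_rewind:
  assumes "\<forall>s \<in> set w. s \<noteq> blank"
  shows "(step ^^ (2 * length w + 2)) (initial_configuration separation_machine w) =
    scan_config (fst (input_tape w)) choosing 0 0 0"
proof -
  define F where "F = fst (input_tape w)"
  define L where "L = length w"
  define part where "part k = (\<lambda>i. if 0 \<le> i \<and> i < int k then w ! nat i else blank)" for k
  define X where "X k = (start_state, [(F, int k), (part k, int k), (part k, int k)])" for k
  define Y where "Y k = scan_config F rewinding (int L - 1 - int k) (int L - 1 - int k) (int L - 1 - int k)" for k
  have F: "F (int k) \<noteq> blank" "F (int k) = w ! k" if "k < L" for k
    using assms that by (auto simp: F_def input_tape_def L_def)
  have "X 0 = initial_configuration separation_machine w"
    by (auto simp: X_def initial_configuration_def separation_machine_def F_def input_tape_def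
        blank_tape_def part_def numeral_2_eq_2 fun_eq_iff)
  moreover have "step (X k) = X (Suc k)" if k: "k < L" for k
  proof -
    have "(part k)(int k := w ! k) = part (Suc k)" by (auto simp: part_def)
    moreover have "F(int k := w ! k) = F" using F(2)[OF k] by auto
    ultimately show ?thesis
      using F[OF k] by (simp add: X_def separation_machine_def numeral_3_eq_3 add.commute)
  qed
  then have "(step ^^ L) (X 0) = X L" by (rule iterate_along)
  moreover have "step (X L) = Y 0"
  proof -
    have "part L = F" by (auto simp: part_def F_def input_tape_def L_def)
    moreover have "F (int L) = blank" by (simp add: F_def input_tape_def L_def)
    moreover from this have "F(int L := blank) = F" by (simp add: fun_upd_idem)
    ultimately show ?thesis
      by (simp add: X_def Y_def scan_config_def separation_machine_def)
  qed
  moreover have "step (Y k) = Y (Suc k)" if k: "k < L" for k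
  proof -
    have pos: "int L - 1 - int k = int (L - Suc k)" using k by simp
    have "F (int L - 1 - int k) \<noteq> blank"
      unfolding pos by (rule F(1)) (use k in simp)
    then show ?thesis unfolding Y_def
      by (subst step_scan_config[where l = Move_Left and m = Move_Left and r = Move_Left])
        (auto simp: scan_def)
  qed
  then have "(step ^^ L) (Y 0) = Y L" by (rule iterate_along)
  moreover have "step (Y L) = scan_config F choosing 0 0 0"
    unfolding Y_def
    by (subst step_scan_config[where l = Move_Right and m = Move_Right and r = Move_Right])
      (auto simp: scan_def F_def input_tape_def)
  moreover have "2 * length w + 2 = 1 + (L + (1 + L))" "step ^^ 1 = step"
    by (simp_all add: L_def)
  ultimately show ?thesis unfolding F_def[symmetric] by (simp only: funpow_add comp_apply)
qed

section \<open>Running the machine on encoded graphs\<close>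

lemma concat_rows_nth:
  assumes "\<And>r. r \<in> set rows \<Longrightarrow> length r = m" "i < length rows" "j < m"
  shows "concat rows ! (i * m + j) = rows ! i ! j"
  using assms
proof (induction rows arbitrary: i)
  case (Cons r rows)
  then show ?case by (cases i) (auto simp: nth_append)
qed simp

lemma length_encode_graph: "length (encode_graph (G, vs)) = length vs * Suc (length vs)"
  by (simp add: encode_graph_def length_concat comp_def sum_list_triv)

lemma encode_graph_nonblank: "\<forall>s \<in> set (encode_graph (G, vs)). s \<noteq> blank"
  by (auto simp: encode_graph_def)

lemma matrix_tape_encode_graph:
  "matrix_tape (fst (input_tape (encode_graph (G, vs)))) (length vs)
    (\<lambda>i j. (vs ! i, vs ! j) \<in> parcs G)"
proof -
  let ?n = "length vs" and ?w = "encode_graph (G, vs)"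
  have nth: "?w ! (i * Suc ?n + j) =
      (if j < ?n then if (vs ! i, vs ! j) \<in> parcs G then bit1 else bit0 else separator)"
    if "i < ?n" "j < Suc ?n" for i j
    unfolding encode_graph_def prod.case
    by (subst concat_rows_nth) (use that in \<open>auto simp: nth_append\<close>)
  have inside: "i * Suc ?n + j < length ?w" if "i < ?n" "j < Suc ?n" for i j
  proof -
    have "Suc i * Suc ?n \<le> ?n * Suc ?n" using that by (intro mult_right_mono) auto
    then show ?thesis using that by (simp add: length_encode_graph)
  qed
  have tape: "fst (input_tape ?w) (int p) = ?w ! p" if "p < length ?w" for p
    using that by (simp add: input_tape_def)
  show ?thesis
  proof
    show "fst (input_tape ?w) (int (i * Suc ?n + j)) =
        (if (vs ! i, vs ! j) \<in> parcs G then bit1 else bit0)" if "i < ?n" "j < ?n" for i j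
      using tape[OF inside[of i j]] nth[of i j] that by simp
    show "fst (input_tape ?w) (int (i * Suc ?n + ?n)) = separator" if "i < ?n" for i
      using tape[OF inside[of i ?n]] nth[of i ?n] that by simp
    show "fst (input_tape ?w) (- 1) = blank" by (simp add: input_tape_def)
    show "fst (input_tape ?w) (int (?n * Suc ?n)) = blank"
      by (simp add: input_tape_def length_encode_graph)
  qed
qed

lemma separation_machine_decides:
  fixes G :: "'a pair_pre_digraph" and vs :: "'a list"
  defines "w \<equiv> encode_graph (G, vs)"
  assumes "set vs = pverts G"
  shows "decides_within separation_machine w (2 * length w ^ 2 + 5 * length w + 3)
    (\<exists>u \<in> pverts G. \<exists>v \<in> pverts G. separated G u v)"
    (is "decides_within _ _ _ ?answer")
proof -
  interpret matrix_tape "fst (input_tape w)" "length vs" "\<lambda>i j. (vs ! i, vs ! j) \<in> parcs G"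
    unfolding w_def by (rule matrix_tape_encode_graph)
  let ?L = "length w"
  have L: "?L = length vs * Suc (length vs)" by (simp add: w_def length_encode_graph)
  have ex_set: "(\<exists>u \<in> set vs. P u) \<longleftrightarrow> (\<exists>i < length vs. P (vs ! i))" for P
    by (auto simp: set_conv_nth)
  have answer: "?answer \<longleftrightarrow>
      (\<exists>i < length vs. \<exists>j < length vs. 0 \<le> i * Suc (length vs) + j \<and> separated_rows i j)"
    unfolding separated_rows_def separated_def assms(2)[symmetric] ex_set by simp
  have "(step ^^ (2 * ?L + 2)) (initial_configuration separation_machine w) = choose_entry 0 0"
    using copy_and_rewind[OF encode_graph_nonblank, of G vs]
    unfolding w_def[symmetric] by (simp add: choose_entry_def)
  moreover have "halts_within (?L * (2 * ?L + 3) + 1) (choose_entry 0 0) ?answer"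
    using choose_entry_decides[of 0] unfolding answer L by simp
  ultimately have "halts_within (2 * ?L + 2 + (?L * (2 * ?L + 3) + 1))
      (initial_configuration separation_machine w) ?answer"
    by (rule halts_within_funpow)
  moreover have "2 * ?L + 2 + (?L * (2 * ?L + 3) + 1) = 2 * ?L ^ 2 + 5 * ?L + 3"
    by (simp add: power2_eq_square algebra_simps)
  ultimately show ?thesis by (simp only: halts_within_def decides_within_def)
qed

text \<open>
  Copying and rewinding take \<open>2 * L + 2\<close> steps for input length \<open>L\<close>, and the main loop at most
  \<open>L * (2 * L + 3) + 1\<close>; the polynomial below is their sum.
\<close>

theorem theorem4:
  shows "\<exists>M. wf_turing_machine M \<and>
    decides_in_poly_time M encode_graph
      {(G :: nat pair_pre_digraph, vs).
         pair_graph G \<and> pverts G \<noteq> {} \<and> \<not> (\<exists>v. universal_vertex G v) \<and>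
         distinct vs \<and> set vs = pverts G}
      (\<lambda>(G, vs). c_min G = 2)"
proof (intro exI conjI)
  show "wf_turing_machine separation_machine" by (rule wf_separation_machine)
  have "decides_within separation_machine (encode_graph (G, vs))
      (poly [:3, 5, 2:] (length (encode_graph (G, vs)))) (c_min G = 2)"
    if "pair_graph G" "pverts G \<noteq> {}" "\<not> (\<exists>v. universal_vertex G v)" "set vs = pverts G"
    for G :: "nat pair_pre_digraph" and vs
  proof -
    interpret graph_without_universal_vertex G
      using that by (simp add: graph_without_universal_vertex_def
          graph_without_universal_vertex_axioms_def)
    have "poly [:3, 5, 2:] k = 2 * k ^ 2 + 5 * k + 3" for k :: nat
      by (simp add: power2_eq_square algebra_simps)
    then show ?thesis
      using separation_machine_decides[OF that(4)] c_min_eq_2_iff_two_part_c_partition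
        two_part_c_partition_iff_separated by (simp only:)
  qed
  then show "decides_in_poly_time separation_machine encode_graph
      {(G :: nat pair_pre_digraph, vs).
         pair_graph G \<and> pverts G \<noteq> {} \<and> \<not> (\<exists>v. universal_vertex G v) \<and>
         distinct vs \<and> set vs = pverts G}
      (\<lambda>(G, vs). c_min G = 2)"
    unfolding decides_in_poly_time_def by (intro exI[of _ "[:3, 5, 2:]"]) auto
qed

end
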